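(* Let $n,k\ge 1$, let $\Omega\subset\mathbb{R}^n$ be a bounded domain with Lipschitz boundary, and let $0<\delta<\delta_0$. Let $\lambda_1^\delta>0$ be the first eigenvalue of the $\delta$-discrete Dirichlet problem for the Laplacian in $\Omega^\delta$, and let $b_\delta>0$ be the unique positive solution of $$\cosh(\delta b_\delta)=1+\frac{1}{2k}\delta^2\lambda_1^\delta .$$ Let $v:\overline{\Omega}^\delta\times(\delta\mathbb{Z})^k\to\mathbb{R}$ be $\delta$-discrete subharmonic in $D^\delta=\Omega^\delta\times(\delta\mathbb{Z})^k$ and such that $v\le 0$ on $\partial\Omega^\delta\times(\delta\mathbb{Z})^k$. Suppose that $$v(x,y)\le o(1)\exp(b_\delta\|y\|_1)\quad\text{when }\|y\|_1\to\infty,$$ i.e. for every $\varepsilon>0$ there is $R>0$ such that $v(x,y)\le\varepsilon\exp(b_\delta\|y\|_1)$ for all $x\in\Omega^\delta$ and all $y\in(\delta\mathbb{Z})^k$ with $\|y\|_1\ge R$. Then $v\le 0$ on $D^\delta$.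
   Context: For $y\in\mathbb{R}^k$, $\|y\|_1=|y_1|+\dots+|y_k|$. Two points of $(\delta\mathbb{Z})^m$ are neighbors if they differ by $\pm\delta e_j$ for some standard basis vector $e_j$. The $\delta$-discrete Laplacian on $(\delta\mathbb{Z})^m$ is $$\Delta_{\delta,m}u(x)=\delta^{-2}\Big(\sum_{j=1}^m\big(u(x+\delta e_j)+u(x-\delta e_j)\big)-2m\,u(x)\Big).$$ $\Omega^\delta=\Omega\cap(\delta\mathbb{Z})^n$; $\partial\Omega^\delta$ is the set of points of $(\delta\mathbb{Z})^n\setminus\Omega^\delta$ having at least one neighbor in $\Omega^\delta$; $\overline{\Omega}^\delta=\Omega^\delta\cup\partial\Omega^\delta$. The number $\delta_0>0$ is fixed, depending on $\Omega$, so small that for $0<\delta<\delta_0$ the set $\Omega^\delta$ is a nonempty discrete domain, i.e. connected in the lattice (any two points are joined by a path of neighboring points in $\Omega^\delta$). A function defined on $\overline{\Omega}^\delta\times(\delta\mathbb{Z})^k$ is $\delta$-discrete subharmonic in $D^\delta=\Omega^\delta\times(\delta\mathbb{Z})^k$ if $\Delta_{\delta,n+k}v\ge 0$ at every point of $D^\delta$. The discrete Dirichlet eigenvalue problem on $\Omega^\delta$ is: $-\Delta_{\delta,n}f=\lambda f$ in $\Omega^\delta$, $f=0$ on $\partial\Omega^\delta$. Its eigenvalues are positive, and $\lambda_1^\delta$ denotes the smallest one. *)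

theory Defs
  imports "HOL-Analysis.Analysis"
begin

text \<open>
  Everything is stated over a Euclidean space, so that the same lattice and the same Laplacian serve
  \<open>real ^ 'n\<close>, \<open>real ^ 'k\<close> and the product \<open>(real ^ 'n) \<times> (real ^ 'k)\<close>, whose standard basis
  consists of the vectors \<open>(e, 0)\<close> and \<open>(0, e')\<close> and whose dimension is \<open>CARD('n) + CARD('k)\<close>.
  Functions on subsets of the lattice are total functions of which only the values
  on the relevant lattice points are ever used.
\<close>

definition grid :: "real \<Rightarrow> 'a::euclidean_space set" where
  "grid \<delta> = {x. \<forall>e\<in>Basis. \<exists>z::int. x \<bullet> e = \<delta> * of_int z}"

definition grid_neighbor :: "real \<Rightarrow> 'a::euclidean_space \<Rightarrow> 'a \<Rightarrow> bool" where
  "grid_neighbor \<delta> x y \<longleftrightarrow> (\<exists>e\<in>Basis. y = x + \<delta> *\<^sub>R e \<or> y = x - \<delta> *\<^sub>R e)"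

definition discrete_laplacian ::
    "real \<Rightarrow> ('a::euclidean_space \<Rightarrow> real) \<Rightarrow> 'a \<Rightarrow> real" where
  "discrete_laplacian \<delta> u x =
     ((\<Sum>e\<in>Basis. u (x + \<delta> *\<^sub>R e) + u (x - \<delta> *\<^sub>R e)) - 2 * real DIM('a) * u x) / \<delta>\<^sup>2"

definition l1_norm :: "'a::euclidean_space \<Rightarrow> real" where
  "l1_norm y = (\<Sum>e\<in>Basis. \<bar>y \<bullet> e\<bar>)"

definition discretization :: "'a::euclidean_space set \<Rightarrow> real \<Rightarrow> 'a set" where
  "discretization \<Omega> \<delta> = \<Omega> \<inter> grid \<delta>"

definition discrete_boundary :: "'a::euclidean_space set \<Rightarrow> real \<Rightarrow> 'a set" where
  "discrete_boundary \<Omega> \<delta> =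
     {x \<in> grid \<delta> - discretization \<Omega> \<delta>. \<exists>y\<in>discretization \<Omega> \<delta>. grid_neighbor \<delta> x y}"

definition grid_connected :: "real \<Rightarrow> 'a::euclidean_space set \<Rightarrow> bool" where
  "grid_connected \<delta> S \<longleftrightarrow>
     (\<forall>x\<in>S. \<forall>y\<in>S. (\<lambda>a b. a \<in> S \<and> b \<in> S \<and> grid_neighbor \<delta> a b)\<^sup>*\<^sup>* x y)"

definition discrete_domain :: "real \<Rightarrow> 'a::euclidean_space set \<Rightarrow> bool" where
  "discrete_domain \<delta> S \<longleftrightarrow> S \<noteq> {} \<and> grid_connected \<delta> S"

definition discrete_subharmonic_on ::
    "real \<Rightarrow> 'a::euclidean_space set \<Rightarrow> ('a \<Rightarrow> real) \<Rightarrow> bool" where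
  "discrete_subharmonic_on \<delta> D v \<longleftrightarrow> (\<forall>p\<in>D. 0 \<le> discrete_laplacian \<delta> v p)"

definition dirichlet_eigenvalue :: "'a::euclidean_space set \<Rightarrow> real \<Rightarrow> real \<Rightarrow> bool" where
  "dirichlet_eigenvalue \<Omega> \<delta> \<mu> \<longleftrightarrow>
     (\<exists>f. (\<exists>x\<in>discretization \<Omega> \<delta>. f x \<noteq> 0) \<and>
          (\<forall>x\<in>discretization \<Omega> \<delta>. - discrete_laplacian \<delta> f x = \<mu> * f x) \<and>
          (\<forall>x\<in>discrete_boundary \<Omega> \<delta>. f x = 0))"

definition first_dirichlet_eigenvalue :: "'a::euclidean_space set \<Rightarrow> real \<Rightarrow> real" where
  "first_dirichlet_eigenvalue \<Omega> \<delta> = (LEAST \<mu>. dirichlet_eigenvalue \<Omega> \<delta> \<mu>)"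

text \<open>
  Lipschitz boundary: near each boundary point, in suitable orthogonal coordinates, the set is the
  strict epigraph of a Lipschitz function.  The last coordinate direction is the unit vector \<open>e\<close>
  (of either sign), the remaining coordinates are given by the orthogonal projection
  onto the hyperplane orthogonal to \<open>e\<close>.
\<close>

definition lipschitz_boundary :: "'a::euclidean_space set \<Rightarrow> bool" where
  "lipschitz_boundary \<Omega> \<longleftrightarrow>
     (\<forall>p\<in>frontier \<Omega>. \<exists>U e \<phi> L.
        open U \<and> p \<in> U \<and> norm e = 1 \<and> L-lipschitz_on {y. y \<bullet> e = 0} \<phi> \<and>
        \<Omega> \<inter> U = {x \<in> U. \<phi> (x - (x \<bullet> e) *\<^sub>R e) < x \<bullet> e})"

definition bounded_lipschitz_domain :: "'a::euclidean_space set \<Rightarrow> bool" where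
  "bounded_lipschitz_domain \<Omega> \<longleftrightarrow>
     open \<Omega> \<and> connected \<Omega> \<and> \<Omega> \<noteq> {} \<and> bounded \<Omega> \<and> lipschitz_boundary \<Omega>"

end

theory Submission
  imports Defs
begin

text \<open>
  A positive discrete harmonic function with exactly the critical growth serves as a barrier.  Let
  \<open>f\<close> be a first Dirichlet eigenfunction, extended by zero.  On the discrete domain \<open>f\<close> is positive,
  and \<open>g y = (\<Prod>j. cosh (b * y\<^sub>j))\<close> satisfies \<open>\<Delta> g = \<lambda>\<^sub>1 g\<close> because of the equation that defines \<open>b\<close>.
  Hence \<open>w (x, y) = f x * g y\<close> is discrete harmonic on the cylinder, it vanishes on the lateral
  boundary, and \<open>w (x, y) \<ge> c * exp (b * \<parallel>y\<parallel>\<^sub>1)\<close> inside, with some \<open>c > 0\<close>.  By the growth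
  assumption, \<open>v - \<epsilon> w\<close> is therefore nonpositive outside a finite part of the cylinder, and by the
  maximum principle it is nonpositive everywhere; letting \<open>\<epsilon>\<close> tend to zero gives \<open>v \<le> 0\<close>.

  The positive eigenfunction comes from a Perron-Frobenius argument for the adjacency kernel of the
  lattice (lemma \<open>symmetric_kernel_perron\<close>): if \<open>h\<close> maximizes the quadratic form on the unit sphere,
  so does \<open>\<bar>h\<bar>\<close>, which is then an eigenfunction for an upper bound of all eigenvalues.  Connectedness
  of the discrete domain makes it positive.
\<close>

section \<open>The maximum principle and finiteness on the lattice\<close>

lemma grid_neighbor_Basis:
  assumes "e \<in> Basis"
  shows "grid_neighbor \<delta> x (x + \<delta> *\<^sub>R e)" and "grid_neighbor \<delta> x (x - \<delta> *\<^sub>R e)"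
  using assms unfolding grid_neighbor_def by blast+

lemma discrete_laplacian_nonneg_iff:
  fixes u :: "'a::euclidean_space \<Rightarrow> real"
  assumes "\<delta> > 0"
  shows "0 \<le> discrete_laplacian \<delta> u p \<longleftrightarrow>
     0 \<le> (\<Sum>e\<in>Basis. (u (p + \<delta> *\<^sub>R e) - u p) + (u (p - \<delta> *\<^sub>R e) - u p))"
proof -
  have "(\<Sum>e\<in>Basis. (u (p + \<delta> *\<^sub>R e) - u p) + (u (p - \<delta> *\<^sub>R e) - u p))
      = (\<Sum>e\<in>Basis. u (p + \<delta> *\<^sub>R e) + u (p - \<delta> *\<^sub>R e)) - 2 * real DIM('a) * u p"
    by (simp add: sum.distrib sum_subtractf algebra_simps)
  then show ?thesis
    using assms by (simp add: discrete_laplacian_def zero_le_divide_iff)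
qed

text \<open>
  Weak maximum principle.  Equality must hold between a positive maximum and all neighboring values,
  so the maximum would propagate in a fixed coordinate direction until it leaves the finite set.
\<close>

lemma discrete_maximum_principle:
  fixes u :: "'a::euclidean_space \<Rightarrow> real"
  assumes "\<delta> > 0" and "finite T"
    and sub: "discrete_subharmonic_on \<delta> T u"
    and bdry: "\<And>p q. p \<in> T \<Longrightarrow> grid_neighbor \<delta> p q \<Longrightarrow> q \<notin> T \<Longrightarrow> u q \<le> 0"
    and "p \<in> T"
  shows "u p \<le> 0"
proof (rule ccontr)
  assume "\<not> u p \<le> 0"
  define m where "m = Max (u ` T)"
  have le_m: "u q \<le> m" if "q \<in> T" for q
    using that \<open>finite T\<close> by (simp add: m_def)
  have "m > 0"
    using le_m[OF \<open>p \<in> T\<close>] \<open>\<not> u p \<le> 0\<close> by linarith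
  define M where "M = {q \<in> T. u q = m}"
  have "m \<in> u ` T"
    unfolding m_def using \<open>finite T\<close> \<open>p \<in> T\<close> by (intro Max_in) auto
  then have "M \<noteq> {}" "finite M"
    using \<open>finite T\<close> by (auto simp: M_def)
  obtain e0 :: 'a where e0: "e0 \<in> Basis"
    using nonempty_Basis by blast
  \<comment> \<open>a maximum point that lies farthest in the direction \<open>e0\<close>\<close>
  obtain q where q: "q \<in> M" and far: "\<And>r. r \<in> M \<Longrightarrow> r \<bullet> e0 \<le> q \<bullet> e0"
    using ex_is_arg_min_if_finite[OF \<open>finite M\<close> \<open>M \<noteq> {}\<close>, of "\<lambda>r. - (r \<bullet> e0)"]
    by (auto simp: is_arg_min_linorder)
  have "q \<in> T" "u q = m"
    using q by (auto simp: M_def)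
  have nb: "u r \<le> m" if "grid_neighbor \<delta> q r" for r
    using that le_m[of r] bdry[OF \<open>q \<in> T\<close> that] \<open>m > 0\<close> by fastforce
  have nonpos: "(u (q + \<delta> *\<^sub>R e) - u q) + (u (q - \<delta> *\<^sub>R e) - u q) \<le> 0" if "e \<in> Basis" for e
    using nb[OF grid_neighbor_Basis(1)[OF that]] nb[OF grid_neighbor_Basis(2)[OF that]] \<open>u q = m\<close>
    by linarith
  have "0 \<le> (\<Sum>e\<in>Basis. (u (q + \<delta> *\<^sub>R e) - u q) + (u (q - \<delta> *\<^sub>R e) - u q))"
    using sub \<open>q \<in> T\<close>
    unfolding discrete_subharmonic_on_def discrete_laplacian_nonneg_iff[OF \<open>\<delta> > 0\<close>] by blast
  moreover have "(\<Sum>e\<in>Basis. (u (q + \<delta> *\<^sub>R e) - u q) + (u (q - \<delta> *\<^sub>R e) - u q)) \<le> 0"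
    by (intro sum_nonpos nonpos)
  ultimately have "(\<Sum>e\<in>Basis. - ((u (q + \<delta> *\<^sub>R e) - u q) + (u (q - \<delta> *\<^sub>R e) - u q))) = 0"
    unfolding sum_negf by linarith
  moreover have "0 \<le> - ((u (q + \<delta> *\<^sub>R e) - u q) + (u (q - \<delta> *\<^sub>R e) - u q))" if "e \<in> Basis" for e
    using nonpos[OF that] by linarith
  ultimately have "- ((u (q + \<delta> *\<^sub>R e0) - u q) + (u (q - \<delta> *\<^sub>R e0) - u q)) = 0"
    by (rule sum_nonneg_0[OF finite_Basis _ _ e0, rotated])
  then have "u (q + \<delta> *\<^sub>R e0) = m"
    using nb[OF grid_neighbor_Basis(1)[OF e0]] nb[OF grid_neighbor_Basis(2)[OF e0]] \<open>u q = m\<close>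
    by linarith
  then have "q + \<delta> *\<^sub>R e0 \<in> M"
    using bdry[OF \<open>q \<in> T\<close> grid_neighbor_Basis(1)[OF e0]] \<open>m > 0\<close> by (auto simp: M_def)
  then have "(q + \<delta> *\<^sub>R e0) \<bullet> e0 \<le> q \<bullet> e0"
    by (rule far)
  then show False
    using \<open>\<delta> > 0\<close> e0 by (simp add: inner_add_left)
qed

lemma finite_bounded_grid:
  fixes A :: "'a::euclidean_space set"
  assumes "\<delta> > 0" and "bounded A"
  shows "finite (A \<inter> grid \<delta>)"
proof -
  obtain B where B: "\<And>x. x \<in> A \<Longrightarrow> norm x \<le> B"
    using \<open>bounded A\<close> by (auto simp: bounded_iff)
  define N where "N = \<lceil>B / \<delta>\<rceil>"
  define F where "F = (\<lambda>z::int. \<delta> * of_int z) ` {-N..N}"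
  have "A \<inter> grid \<delta> \<subseteq> (\<lambda>\<phi>. \<Sum>e\<in>Basis. \<phi> e *\<^sub>R e) ` (Basis \<rightarrow>\<^sub>E F)"
  proof
    fix x assume x: "x \<in> A \<inter> grid \<delta>"
    have "x \<bullet> e \<in> F" if e: "e \<in> Basis" for e
    proof -
      obtain z :: int where z: "x \<bullet> e = \<delta> * of_int z"
        using x e by (auto simp: grid_def)
      have "\<bar>x \<bullet> e\<bar> \<le> B"
        using Basis_le_norm[OF e, of x] B[of x] x by auto
      then have "\<bar>of_int z\<bar> \<le> B / \<delta>"
        using \<open>\<delta> > 0\<close> by (simp add: z abs_mult field_simps)
      then have "\<bar>z\<bar> \<le> N"
        unfolding N_def by linarith
      then show ?thesis
        unfolding F_def z by (intro imageI) auto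
    qed
    then have "restrict (\<lambda>e. x \<bullet> e) Basis \<in> Basis \<rightarrow>\<^sub>E F"
      by auto
    moreover have "x = (\<Sum>e\<in>Basis. restrict (\<lambda>e. x \<bullet> e) Basis e *\<^sub>R e)"
      by (simp add: euclidean_representation)
    ultimately show "x \<in> (\<lambda>\<phi>. \<Sum>e\<in>Basis. \<phi> e *\<^sub>R e) ` (Basis \<rightarrow>\<^sub>E F)"
      by blast
  qed
  moreover have "finite ((\<lambda>\<phi>. \<Sum>e\<in>Basis. \<phi> e *\<^sub>R e) ` (Basis \<rightarrow>\<^sub>E F) :: 'a set)"
    by (intro finite_imageI finite_PiE) (auto simp: F_def)
  ultimately show ?thesis
    by (rule finite_subset)
qed

lemma grid_add_Basis:
  assumes "x \<in> grid \<delta>" and "e \<in> Basis"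
  shows "x + \<delta> *\<^sub>R e \<in> grid \<delta>" and "x - \<delta> *\<^sub>R e \<in> grid \<delta>"
proof -
  have "\<exists>z::int. (x + s *\<^sub>R \<delta> *\<^sub>R e) \<bullet> e' = \<delta> * of_int z"
    if "e' \<in> Basis" and s: "s = of_int t" for e' s and t :: int
  proof -
    obtain z :: int where "x \<bullet> e' = \<delta> * of_int z"
      using assms(1) \<open>e' \<in> Basis\<close> by (auto simp: grid_def)
    then have "(x + s *\<^sub>R \<delta> *\<^sub>R e) \<bullet> e' = \<delta> * of_int (z + (if e' = e then t else 0))"
      using assms(2) that by (simp add: inner_add_left inner_Basis algebra_simps)
    then show ?thesis by blast
  qed
  from this[of _ 1 1] this[of _ "-1" "-1"]
  show "x + \<delta> *\<^sub>R e \<in> grid \<delta>" and "x - \<delta> *\<^sub>R e \<in> grid \<delta>"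
    by (auto simp: grid_def)
qed

lemma grid_neighbor_in_grid:
  "grid_neighbor \<delta> x y \<Longrightarrow> x \<in> grid \<delta> \<Longrightarrow> y \<in> grid \<delta>"
  using grid_add_Basis by (auto simp: grid_neighbor_def)

lemma grid_neighbor_sym: "grid_neighbor \<delta> x y \<Longrightarrow> grid_neighbor \<delta> y x"
  by (auto simp: grid_neighbor_def)

lemma neighbor_in_discrete_boundary:
  assumes "x \<in> discretization \<Omega> \<delta>" and "grid_neighbor \<delta> x y" and "y \<notin> discretization \<Omega> \<delta>"
  shows "y \<in> discrete_boundary \<Omega> \<delta>"
  using assms grid_neighbor_in_grid[OF assms(2)] grid_neighbor_sym[OF assms(2)]
  by (auto simp: discrete_boundary_def discretization_def)

section \<open>The positive first Dirichlet eigenfunction\<close>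

lemma linear_le_quadratic_imp_zero:
  fixes a c :: real
  assumes "\<And>t. 2 * t * a \<le> t\<^sup>2 * c"
  shows "a = 0"
proof (rule ccontr)
  assume "a \<noteq> 0"
  define d where "d = \<bar>c\<bar> + 1"
  have "d > 0" "c < d"
    by (auto simp: d_def)
  have "2 * (a / d) * a \<le> (a / d)\<^sup>2 * c"
    by (rule assms)
  also have "\<dots> \<le> (a / d)\<^sup>2 * d"
    using \<open>c < d\<close> by (intro mult_left_mono) auto
  also have "\<dots> = (a / d) * a"
    using \<open>d > 0\<close> by (simp add: power2_eq_square)
  finally have "(a / d) * a \<le> 0"
    by simp
  then have "a * a \<le> 0"
    using \<open>d > 0\<close> by (simp add: field_simps)
  then show False
    using \<open>a \<noteq> 0\<close> by (metis mult_le_0_iff linorder_not_less not_less_iff_gr_or_eq)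
qed

text \<open>
  Functions on the finite set \<open>S\<close> are extended by zero here, so that the unit sphere becomes a closed
  subset of a product of compact sets.  The bound for general \<open>g\<close> follows by homogeneity.
\<close>

lemma sphere_maximizer_exists:
  fixes K :: "'a \<Rightarrow> 'a \<Rightarrow> real"
  assumes "finite S" and "S \<noteq> {}"
  obtains h where "(\<Sum>x\<in>S. (h x)\<^sup>2) = 1"
    and "\<And>g. (\<Sum>x\<in>S. \<Sum>y\<in>S. K x y * g x * g y)
           \<le> (\<Sum>x\<in>S. \<Sum>y\<in>S. K x y * h x * h y) * (\<Sum>x\<in>S. (g x)\<^sup>2)"
proof -
  define Q where "Q g = (\<Sum>x\<in>S. \<Sum>y\<in>S. K x y * g x * g y)" for g :: "'a \<Rightarrow> real"
  define C where "C = Pi\<^sub>E UNIV (\<lambda>x. if x \<in> S then {-1..1::real} else {0})"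
  define U where "U = {g \<in> C. (\<Sum>x\<in>S. (g x)\<^sup>2) = 1}"
  have "compactin (product_topology (\<lambda>_. euclidean) UNIV) C"
    unfolding C_def compactin_PiE by (auto simp: compactin_euclidean_iff)
  then have "compact C"
    by (simp add: euclidean_product_topology compactin_euclidean_iff)
  moreover have "closed {g :: 'a \<Rightarrow> real. (\<Sum>x\<in>S. (g x)\<^sup>2) = 1}"
    by (intro closed_Collect_eq continuous_intros continuous_on_product_coordinates)
  ultimately have "compact U"
    unfolding U_def Collect_conj_eq by (simp add: compact_Int_closed)
  have normalized: "(\<lambda>x. if x \<in> S then g x / sqrt N else 0) \<in> U"
    if N: "N = (\<Sum>x\<in>S. (g x)\<^sup>2)" "N > 0" for g N
  proof -
    have "g x / sqrt N \<in> {-1..1}" if "x \<in> S" for x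
    proof -
      have "(g x)\<^sup>2 \<le> N"
        unfolding N using \<open>finite S\<close> that by (intro member_le_sum) auto
      then have "\<bar>g x\<bar> \<le> sqrt N"
        by (metis real_sqrt_abs real_sqrt_le_iff)
      then have "\<bar>g x / sqrt N\<bar> \<le> 1"
        using \<open>N > 0\<close> by simp
      then show ?thesis
        unfolding atLeastAtMost_iff by linarith
    qed
    moreover have "(\<Sum>x\<in>S. (g x / sqrt N)\<^sup>2) = 1"
    proof -
      have "(\<Sum>x\<in>S. (g x / sqrt N)\<^sup>2) = (\<Sum>x\<in>S. (g x)\<^sup>2) / N"
        using \<open>N > 0\<close> by (simp add: power_divide sum_divide_distrib)
      then show ?thesis
        using N by simp
    qed
    ultimately show ?thesis
      by (simp add: U_def C_def PiE_iff)
  qed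
  have "(\<Sum>x\<in>S. (1::real)\<^sup>2) > 0"
    using assms by (simp add: card_gt_0_iff)
  from normalized[OF refl this] have "U \<noteq> {}"
    by blast
  moreover have "continuous_on U Q"
    unfolding Q_def
    by (intro continuous_intros continuous_on_subset[OF continuous_on_product_coordinates]) auto
  ultimately obtain h where "h \<in> U" and h: "\<And>g. g \<in> U \<Longrightarrow> Q g \<le> Q h"
    using continuous_attains_sup[OF \<open>compact U\<close>] by blast
  show thesis
  proof
    show "(\<Sum>x\<in>S. (h x)\<^sup>2) = 1"
      using \<open>h \<in> U\<close> by (simp add: U_def)
    fix g :: "'a \<Rightarrow> real"
    define N where "N = (\<Sum>x\<in>S. (g x)\<^sup>2)"
    have "N \<ge> 0"
      by (auto simp: N_def intro: sum_nonneg)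
    have "Q g \<le> Q h * N"
    proof (cases "N = 0")
      case True
      then have "\<And>x. x \<in> S \<Longrightarrow> g x = 0"
        using \<open>finite S\<close> by (auto simp: N_def sum_nonneg_eq_0_iff)
      then show ?thesis
        using True by (simp add: Q_def)
    next
      case False
      then have "N > 0"
        using \<open>N \<ge> 0\<close> by simp
      have "Q (\<lambda>x. if x \<in> S then g x / sqrt N else 0) = Q g / N"
        using \<open>N > 0\<close> unfolding Q_def sum_divide_distrib
        by (intro sum.cong refl) (simp add: field_simps)
      then have "Q g / N \<le> Q h"
        using h[OF normalized[OF N_def \<open>N > 0\<close>]] by simp
      then show ?thesis
        using \<open>N > 0\<close> by (simp add: field_simps)
    qed
    then show "(\<Sum>x\<in>S. \<Sum>y\<in>S. K x y * g x * g y)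
        \<le> (\<Sum>x\<in>S. \<Sum>y\<in>S. K x y * h x * h y) * (\<Sum>x\<in>S. (g x)\<^sup>2)"
      by (simp add: Q_def N_def)
  qed
qed

text \<open>
  The last conclusion bounds every eigenvalue of the kernel by \<open>M\<close>.  Nonnegativity of the kernel is
  what allows a maximizer of the quadratic form to be replaced by its absolute value.
\<close>

lemma symmetric_kernel_perron:
  fixes K :: "'a \<Rightarrow> 'a \<Rightarrow> real"
  assumes "finite S" and "S \<noteq> {}"
    and sym: "\<And>x y. K x y = K y x" and nonneg: "\<And>x y. 0 \<le> K x y"
  obtains M f where "\<And>x. 0 \<le> f x" and "\<exists>x\<in>S. f x \<noteq> 0"
    and "\<And>x. x \<in> S \<Longrightarrow> (\<Sum>y\<in>S. K x y * f y) = M * f x"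
    and "\<And>g. (\<Sum>x\<in>S. \<Sum>y\<in>S. K x y * g x * g y) \<le> M * (\<Sum>x\<in>S. (g x)\<^sup>2)"
proof -
  define Q where "Q g = (\<Sum>x\<in>S. \<Sum>y\<in>S. K x y * g x * g y)" for g :: "'a \<Rightarrow> real"
  obtain h where h1: "(\<Sum>x\<in>S. (h x)\<^sup>2) = 1"
    and hmax: "\<And>g. Q g \<le> Q h * (\<Sum>x\<in>S. (g x)\<^sup>2)"
    by (rule sphere_maximizer_exists[OF assms(1,2), of K, folded Q_def]) (rule that)
  define f where "f x = \<bar>h x\<bar>" for x
  have f1: "(\<Sum>x\<in>S. (f x)\<^sup>2) = 1"
    using h1 by (simp add: f_def)
  have "Q h \<le> Q f"
    unfolding Q_def f_def
  proof (intro sum_mono)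
    fix x y
    have "K x y * (h x * h y) \<le> K x y * (\<bar>h x\<bar> * \<bar>h y\<bar>)"
      by (intro mult_left_mono nonneg) (metis abs_ge_self abs_mult)
    then show "K x y * h x * h y \<le> K x y * \<bar>h x\<bar> * \<bar>h y\<bar>"
      by (simp add: mult.assoc)
  qed
  moreover have "Q f \<le> Q h"
    using hmax[of f] f1 by simp
  ultimately have Qf: "Q f = Q h"
    by simp
  show thesis
  proof
    show "0 \<le> f x" for x
      by (simp add: f_def)
    show "\<exists>x\<in>S. f x \<noteq> 0"
    proof (rule ccontr)
      assume "\<not> ?thesis"
      then have "(\<Sum>x\<in>S. (f x)\<^sup>2) = 0"
        by (intro sum.neutral) auto
      then show False
        using f1 by simp
    qed
    show "(\<Sum>x\<in>S. \<Sum>y\<in>S. K x y * g x * g y) \<le> Q h * (\<Sum>x\<in>S. (g x)\<^sup>2)" for g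
      using hmax[of g] by (simp add: Q_def)
    fix z assume z: "z \<in> S"
    define L where "L = (\<Sum>y\<in>S. K z y * f y)"
    \<comment> \<open>first variation of the quadratic form in the direction of the point mass at \<open>z\<close>\<close>
    have "2 * t * (L - Q h * f z) \<le> t\<^sup>2 * (Q h - K z z)" for t
    proof -
      define d where "d x = (if x = z then t else 0)" for x
      have N: "(\<Sum>x\<in>S. (f x + d x)\<^sup>2) = 1 + 2 * t * f z + t\<^sup>2"
      proof -
        have "(\<Sum>x\<in>S. (f x + d x)\<^sup>2)
            = (\<Sum>x\<in>S. (f x)\<^sup>2 + (if x = z then 2 * t * f z + t\<^sup>2 else 0))"
          by (intro sum.cong refl) (auto simp: d_def power2_eq_square algebra_simps)
        then show ?thesis
          using f1 z \<open>finite S\<close> by (simp add: sum.distrib)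
      qed
      have "Q (\<lambda>x. f x + d x) = Q f + (\<Sum>x\<in>S. \<Sum>y\<in>S. K x y * d x * f y)
          + (\<Sum>x\<in>S. \<Sum>y\<in>S. K x y * f x * d y) + (\<Sum>x\<in>S. \<Sum>y\<in>S. K x y * d x * d y)"
        by (simp add: Q_def sum.distrib algebra_simps)
      moreover have A: "(\<Sum>x\<in>S. \<Sum>y\<in>S. K x y * d x * f y) = t * L"
      proof -
        have "(\<Sum>x\<in>S. \<Sum>y\<in>S. K x y * d x * f y) = (\<Sum>x\<in>S. if x = z then t * L else 0)"
          by (intro sum.cong refl) (auto simp: d_def L_def sum_distrib_left algebra_simps)
        then show ?thesis
          using z \<open>finite S\<close> by simp
      qed
      moreover have "(\<Sum>x\<in>S. \<Sum>y\<in>S. K x y * f x * d y) = t * L"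
        unfolding A[symmetric] by (subst sum.swap) (simp add: sym mult_ac)
      moreover have "(\<Sum>x\<in>S. \<Sum>y\<in>S. K x y * d x * d y) = t\<^sup>2 * K z z"
      proof -
        have "(\<Sum>y\<in>S. K x y * d x * d y) = (if x = z then t\<^sup>2 * K z z else 0)" for x
        proof -
          have "(\<Sum>y\<in>S. K x y * d x * d y) = (\<Sum>y\<in>S. if y = z then K x z * d x * t else 0)"
            by (intro sum.cong refl) (auto simp: d_def)
          then show ?thesis
            using z \<open>finite S\<close> by (simp add: d_def power2_eq_square)
        qed
        then show ?thesis
          using z \<open>finite S\<close> by simp
      qed
      ultimately have "Q h + 2 * t * L + t\<^sup>2 * K z z \<le> Q h * (1 + 2 * t * f z + t\<^sup>2)"
        using hmax[of "\<lambda>x. f x + d x"] N Qf by (simp add: mult_ac)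
      then show ?thesis
        by (simp add: algebra_simps)
    qed
    then have "L - Q h * f z = 0"
      by (rule linear_le_quadratic_imp_zero)
    then show "(\<Sum>y\<in>S. K z y * f y) = Q h * f z"
      by (simp add: L_def)
  qed
qed

text \<open>The adjacency kernel of the lattice, counting the steps that lead from \<open>x\<close> to \<open>y\<close>.\<close>

definition grid_kernel :: "real \<Rightarrow> 'a::euclidean_space \<Rightarrow> 'a \<Rightarrow> real" where
  "grid_kernel \<delta> x y = (\<Sum>e\<in>Basis. of_bool (y = x + \<delta> *\<^sub>R e) + of_bool (y = x - \<delta> *\<^sub>R e))"

lemma grid_kernel_sym: "grid_kernel \<delta> x y = grid_kernel \<delta> y x"
  unfolding grid_kernel_def
proof (intro sum.cong refl)
  fix e
  have "(y = x + \<delta> *\<^sub>R e) = (x = y - \<delta> *\<^sub>R e)" "(y = x - \<delta> *\<^sub>R e) = (x = y + \<delta> *\<^sub>R e)"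
    by auto
  then show "of_bool (y = x + \<delta> *\<^sub>R e) + of_bool (y = x - \<delta> *\<^sub>R e)
      = of_bool (x = y + \<delta> *\<^sub>R e) + (of_bool (x = y - \<delta> *\<^sub>R e) :: real)"
    by simp
qed

lemma grid_kernel_nonneg: "0 \<le> grid_kernel \<delta> x y"
  by (auto simp: grid_kernel_def intro: sum_nonneg)

lemma grid_kernel_pos: "grid_neighbor \<delta> x y \<Longrightarrow> 0 < grid_kernel \<delta> x y"
  unfolding grid_kernel_def grid_neighbor_def
  by (elim bexE, rule sum_pos2) (auto simp: add_pos_nonneg add_nonneg_pos)

text \<open>
  For functions that vanish at the neighbors outside \<open>S\<close>, the Laplacian only involves the kernel
  restricted to \<open>S\<close>.  The Dirichlet eigenvalues in dimension \<open>n\<close> are therefore the numbers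
  \<open>(2 n - M) / \<delta>\<^sup>2\<close> with \<open>M\<close> an eigenvalue of the restricted kernel, and the largest \<open>M\<close> gives the first one.
\<close>

lemma discrete_laplacian_kernel:
  fixes g :: "'a::euclidean_space \<Rightarrow> real"
  assumes "finite S" and zero: "\<And>y. grid_neighbor \<delta> x y \<Longrightarrow> y \<notin> S \<Longrightarrow> g y = 0"
  shows "discrete_laplacian \<delta> g x
    = ((\<Sum>y\<in>S. grid_kernel \<delta> x y * g y) - 2 * real DIM('a) * g x) / \<delta>\<^sup>2"
proof -
  have "(\<Sum>y\<in>S. of_bool (y = q) * g y) = g q" if "grid_neighbor \<delta> x q" for q
  proof -
    have "(\<Sum>y\<in>S. of_bool (y = q) * g y) = (\<Sum>y\<in>S. if y = q then g q else 0)"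
      by (intro sum.cong refl) auto
    then show ?thesis
      using zero[OF that] \<open>finite S\<close> by auto
  qed
  then have "(\<Sum>e\<in>Basis. g (x + \<delta> *\<^sub>R e) + g (x - \<delta> *\<^sub>R e))
      = (\<Sum>e\<in>Basis. \<Sum>y\<in>S. (of_bool (y = x + \<delta> *\<^sub>R e) + of_bool (y = x - \<delta> *\<^sub>R e)) * g y)"
    by (intro sum.cong refl) (simp add: grid_neighbor_Basis distrib_right sum.distrib)
  also have "\<dots> = (\<Sum>y\<in>S. grid_kernel \<delta> x y * g y)"
    by (subst sum.swap) (simp add: grid_kernel_def sum_distrib_right)
  finally show ?thesis
    by (simp add: discrete_laplacian_def)
qed

text \<open>
  Irreducibility of the kernel: on a discrete domain, a nonnegative eigenfunction has no zeros.
\<close>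

lemma kernel_eigenfunction_pos:
  fixes f :: "'a::euclidean_space \<Rightarrow> real"
  assumes "finite S" and conn: "grid_connected \<delta> S"
    and nonneg: "\<And>x. 0 \<le> f x" and "\<exists>x\<in>S. f x \<noteq> 0"
    and eig: "\<And>x. x \<in> S \<Longrightarrow> (\<Sum>y\<in>S. grid_kernel \<delta> x y * f y) = M * f x"
    and "x \<in> S"
  shows "0 < f x"
proof (rule ccontr)
  assume "\<not> 0 < f x"
  then have "f x = 0"
    using nonneg[of x] by simp
  obtain y where y: "y \<in> S" "f y \<noteq> 0"
    using assms by blast
  have "(\<lambda>a b. a \<in> S \<and> b \<in> S \<and> grid_neighbor \<delta> a b)\<^sup>*\<^sup>* x y"
    using conn y \<open>x \<in> S\<close> by (auto simp: grid_connected_def)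
  \<comment> \<open>a zero of \<open>f\<close> forces zeros at all its neighbors in \<open>S\<close>, hence along the whole path\<close>
  then have "f y = 0"
  proof (induction rule: rtranclp_induct)
    case base
    show ?case by fact
  next
    case (step a b)
    then have "(\<Sum>c\<in>S. grid_kernel \<delta> a c * f c) = 0"
      using eig[of a] by simp
    moreover have "0 \<le> grid_kernel \<delta> a c * f c" for c
      by (intro mult_nonneg_nonneg grid_kernel_nonneg nonneg)
    ultimately have "grid_kernel \<delta> a b * f b = 0"
      using \<open>finite S\<close> step by (subst (asm) sum_nonneg_eq_0_iff) auto
    then show ?case
      using grid_kernel_pos[of \<delta> a b] step by simp
  qed
  then show False
    using y by simp
qed

text \<open>
  In particular the set of Dirichlet eigenvalues has a least element, so that
  \<^const>\<open>first_dirichlet_eigenvalue\<close> is a genuine eigenvalue.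
\<close>

lemma positive_first_dirichlet_eigenfunction:
  fixes \<Omega> :: "'a::euclidean_space set"
  assumes "\<delta> > 0" and "bounded \<Omega>" and dom: "discrete_domain \<delta> (discretization \<Omega> \<delta>)"
  obtains f where "\<And>x. x \<in> discretization \<Omega> \<delta> \<Longrightarrow> 0 < f x"
    and "\<And>x. x \<notin> discretization \<Omega> \<delta> \<Longrightarrow> f x = 0"
    and "\<And>x. x \<in> discretization \<Omega> \<delta> \<Longrightarrow>
          - discrete_laplacian \<delta> f x = first_dirichlet_eigenvalue \<Omega> \<delta> * f x"
proof -
  define S where "S = discretization \<Omega> \<delta>"
  have "finite S"
    using finite_bounded_grid[OF assms(1,2)] by (simp add: S_def discretization_def)
  have "S \<noteq> {}" "grid_connected \<delta> S"
    using dom by (auto simp: S_def discrete_domain_def)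
  obtain M h where h0: "\<And>x. 0 \<le> h x" and hne: "\<exists>x\<in>S. h x \<noteq> 0"
    and eig: "\<And>x. x \<in> S \<Longrightarrow> (\<Sum>y\<in>S. grid_kernel \<delta> x y * h y) = M * h x"
    and M: "\<And>g. (\<Sum>x\<in>S. \<Sum>y\<in>S. grid_kernel \<delta> x y * g x * g y) \<le> M * (\<Sum>x\<in>S. (g x)\<^sup>2)"
    by (rule symmetric_kernel_perron[where K = "grid_kernel \<delta>",
          OF \<open>finite S\<close> \<open>S \<noteq> {}\<close> grid_kernel_sym grid_kernel_nonneg]) (rule that)
  define f where "f x = (if x \<in> S then h x else 0)" for x
  define l where "l = (2 * real DIM('a) - M) / \<delta>\<^sup>2"
  have pos: "0 < f x" if "x \<in> S" for x
    using kernel_eigenfunction_pos[OF \<open>finite S\<close> \<open>grid_connected \<delta> S\<close> h0 hne eig that] that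
    by (simp add: f_def)
  have lap: "- discrete_laplacian \<delta> f x = l * f x" if "x \<in> S" for x
  proof -
    have "(\<Sum>y\<in>S. grid_kernel \<delta> x y * f y) = M * f x"
      using eig[OF that] that by (simp add: f_def)
    moreover have "discrete_laplacian \<delta> f x
        = ((\<Sum>y\<in>S. grid_kernel \<delta> x y * f y) - 2 * real DIM('a) * f x) / \<delta>\<^sup>2"
      by (rule discrete_laplacian_kernel[OF \<open>finite S\<close>]) (simp add: f_def)
    ultimately show ?thesis
      using \<open>\<delta> > 0\<close> by (simp add: l_def field_simps)
  qed
  have "first_dirichlet_eigenvalue \<Omega> \<delta> = l"
    unfolding first_dirichlet_eigenvalue_def
  proof (rule Least_equality)
    have "\<exists>x\<in>S. f x \<noteq> 0"
      using hne by (auto simp: f_def)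
    moreover have "\<forall>x\<in>discrete_boundary \<Omega> \<delta>. f x = 0"
      by (auto simp: f_def S_def discrete_boundary_def)
    ultimately show "dirichlet_eigenvalue \<Omega> \<delta> l"
      unfolding dirichlet_eigenvalue_def using lap by (auto simp: S_def)
  next
    fix \<mu> assume "dirichlet_eigenvalue \<Omega> \<delta> \<mu>"
    then obtain g where gne: "\<exists>x\<in>S. g x \<noteq> 0"
      and geig: "\<And>x. x \<in> S \<Longrightarrow> - discrete_laplacian \<delta> g x = \<mu> * g x"
      and gb: "\<And>x. x \<in> discrete_boundary \<Omega> \<delta> \<Longrightarrow> g x = 0"
      by (auto simp: dirichlet_eigenvalue_def S_def)
    define N where "N = (\<Sum>x\<in>S. (g x)\<^sup>2)"
    have "N > 0"
      using gne \<open>finite S\<close> unfolding N_def by (auto intro!: sum_pos2)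
    have row: "(\<Sum>y\<in>S. grid_kernel \<delta> x y * g y) = (2 * real DIM('a) - \<delta>\<^sup>2 * \<mu>) * g x" if "x \<in> S" for x
    proof -
      have "discrete_laplacian \<delta> g x
          = ((\<Sum>y\<in>S. grid_kernel \<delta> x y * g y) - 2 * real DIM('a) * g x) / \<delta>\<^sup>2"
        using neighbor_in_discrete_boundary[of x \<Omega> \<delta>] that gb
        by (intro discrete_laplacian_kernel[OF \<open>finite S\<close>]) (auto simp: S_def)
      moreover have "discrete_laplacian \<delta> g x = - (\<mu> * g x)"
        using geig[OF that] by simp
      ultimately show ?thesis
        using \<open>\<delta> > 0\<close> by (simp add: field_simps)
    qed
    have "(\<Sum>x\<in>S. g x * (\<Sum>y\<in>S. grid_kernel \<delta> x y * g y))
        = (\<Sum>x\<in>S. (2 * real DIM('a) - \<delta>\<^sup>2 * \<mu>) * (g x)\<^sup>2)"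
      by (intro sum.cong refl) (simp add: row power2_eq_square)
    also have "\<dots> = (2 * real DIM('a) - \<delta>\<^sup>2 * \<mu>) * N"
      by (simp add: N_def sum_distrib_left)
    finally have "(\<Sum>x\<in>S. g x * (\<Sum>y\<in>S. grid_kernel \<delta> x y * g y))
        = (2 * real DIM('a) - \<delta>\<^sup>2 * \<mu>) * N" .
    moreover have "(\<Sum>x\<in>S. g x * (\<Sum>y\<in>S. grid_kernel \<delta> x y * g y))
        = (\<Sum>x\<in>S. \<Sum>y\<in>S. grid_kernel \<delta> x y * g x * g y)"
      by (simp add: sum_distrib_left mult_ac)
    ultimately have "(2 * real DIM('a) - \<delta>\<^sup>2 * \<mu>) * N \<le> M * N"
      using M[of g] by (simp add: N_def)
    then have "2 * real DIM('a) - \<delta>\<^sup>2 * \<mu> \<le> M"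
      using \<open>N > 0\<close> by simp
    then show "l \<le> \<mu>"
      using \<open>\<delta> > 0\<close> by (simp add: l_def field_simps)
  qed
  then show thesis
    using that[of f] pos lap by (auto simp: S_def f_def)
qed

section \<open>The harmonic barrier\<close>

lemma sum_Basis_prod:
  fixes F :: "'a::euclidean_space \<times> 'b::euclidean_space \<Rightarrow> real"
  shows "sum F Basis = (\<Sum>e\<in>Basis. F (e, 0)) + (\<Sum>e\<in>Basis. F (0, e))"
proof -
  have "inj_on (\<lambda>u. (u::'a, 0::'b)) Basis" "inj_on (\<lambda>u. (0::'a, u::'b)) Basis"
    by (auto intro: inj_onI)
  then show ?thesis
    unfolding Basis_prod_def
    by (subst sum.union_disjoint) (auto simp: Basis_prod_def sum.reindex)
qed

lemma discrete_laplacian_product: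
  fixes f :: "'a::euclidean_space \<Rightarrow> real" and g :: "'b::euclidean_space \<Rightarrow> real"
  shows "discrete_laplacian \<delta> (\<lambda>p. f (fst p) * g (snd p)) (x, y)
    = discrete_laplacian \<delta> f x * g y + f x * discrete_laplacian \<delta> g y"
proof -
  have "(\<Sum>e\<in>Basis. f (x + \<delta> *\<^sub>R e) * g y + f (x - \<delta> *\<^sub>R e) * g y)
      = (\<Sum>e\<in>Basis. f (x + \<delta> *\<^sub>R e) + f (x - \<delta> *\<^sub>R e)) * g y"
    by (simp add: sum_distrib_right distrib_right)
  moreover have "(\<Sum>e\<in>Basis. f x * g (y + \<delta> *\<^sub>R e) + f x * g (y - \<delta> *\<^sub>R e))
      = f x * (\<Sum>e\<in>Basis. g (y + \<delta> *\<^sub>R e) + g (y - \<delta> *\<^sub>R e))"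
    by (simp add: sum_distrib_left distrib_left)
  ultimately show ?thesis
    unfolding discrete_laplacian_def sum_Basis_prod
    by (simp add: algebra_simps flip: add_divide_distrib)
qed

lemma discrete_laplacian_diff_scale:
  "discrete_laplacian \<delta> (\<lambda>p. u p - c * w p) p
    = discrete_laplacian \<delta> u p - c * discrete_laplacian \<delta> w p"
proof -
  have "(\<Sum>e\<in>Basis. u (p + \<delta> *\<^sub>R e) - c * w (p + \<delta> *\<^sub>R e) + (u (p - \<delta> *\<^sub>R e) - c * w (p - \<delta> *\<^sub>R e)))
      = (\<Sum>e\<in>Basis. (u (p + \<delta> *\<^sub>R e) + u (p - \<delta> *\<^sub>R e)) - c * (w (p + \<delta> *\<^sub>R e) + w (p - \<delta> *\<^sub>R e)))"
    by (intro sum.cong refl) (simp add: distrib_left)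
  also have "\<dots> = (\<Sum>e\<in>Basis. u (p + \<delta> *\<^sub>R e) + u (p - \<delta> *\<^sub>R e))
      - c * (\<Sum>e\<in>Basis. w (p + \<delta> *\<^sub>R e) + w (p - \<delta> *\<^sub>R e))"
    by (simp only: sum_subtractf sum_distrib_left)
  finally show ?thesis
    by (simp add: discrete_laplacian_def right_diff_distrib diff_divide_distrib)
qed

text \<open>
  Each factor contributes the same amount, since
  \<open>cosh (s + \<delta> * b) + cosh (s - \<delta> * b) = 2 * cosh (\<delta> * b) * cosh s\<close>.
\<close>

lemma discrete_laplacian_prod_cosh:
  fixes y :: "'a::euclidean_space"
  shows "discrete_laplacian \<delta> (\<lambda>y. \<Prod>e\<in>Basis. cosh (b * (y \<bullet> e))) y
    = 2 * real DIM('a) * (cosh (\<delta> * b) - 1) / \<delta>\<^sup>2 * (\<Prod>e\<in>Basis. cosh (b * (y \<bullet> e)))"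
proof -
  define g where "g y = (\<Prod>e\<in>Basis. cosh (b * (y \<bullet> e)))" for y :: 'a
  have shift: "g (y + s *\<^sub>R e) = cosh (b * (y \<bullet> e) + s * b) * (\<Prod>e'\<in>Basis - {e}. cosh (b * (y \<bullet> e')))"
    if "e \<in> Basis" for e s
  proof -
    have "(\<Prod>e'\<in>Basis - {e}. cosh (b * ((y + s *\<^sub>R e) \<bullet> e')))
        = (\<Prod>e'\<in>Basis - {e}. cosh (b * (y \<bullet> e')))"
      using that by (intro prod.cong refl) (auto simp: inner_add_left inner_Basis)
    then show ?thesis
      using that by (simp add: g_def prod.remove[OF finite_Basis that] inner_add_left algebra_simps)
  qed
  have "g (y + \<delta> *\<^sub>R e) + g (y - \<delta> *\<^sub>R e) = 2 * cosh (\<delta> * b) * g y" if "e \<in> Basis" for e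
    using shift[OF that, of \<delta>] shift[OF that, of "- \<delta>"] shift[OF that, of 0]
    by (simp add: cosh_add cosh_diff algebra_simps)
  then have "(\<Sum>e\<in>Basis. g (y + \<delta> *\<^sub>R e) + g (y - \<delta> *\<^sub>R e)) = real DIM('a) * (2 * cosh (\<delta> * b) * g y)"
    by simp
  then have "discrete_laplacian \<delta> g y = 2 * real DIM('a) * (cosh (\<delta> * b) - 1) / \<delta>\<^sup>2 * g y"
    by (simp add: discrete_laplacian_def algebra_simps)
  then show ?thesis
    by (simp add: g_def[abs_def])
qed

lemma exp_l1_norm_le_prod_cosh:
  fixes y :: "'a::euclidean_space"
  assumes "b > 0"
  shows "exp (b * l1_norm y) \<le> 2 ^ DIM('a) * (\<Prod>e\<in>Basis. cosh (b * (y \<bullet> e)))"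
proof -
  have "exp (b * l1_norm y) = (\<Prod>e\<in>Basis. exp (b * \<bar>y \<bullet> e\<bar>))"
    by (simp add: l1_norm_def sum_distrib_left exp_sum)
  also have "\<dots> \<le> (\<Prod>e\<in>(Basis::'a set). 2 * cosh (b * (y \<bullet> e)))"
  proof (rule prod_mono)
    fix e :: 'a
    have "exp \<bar>t\<bar> \<le> 2 * cosh t" for t :: real
      by (simp add: cosh_def abs_if)
    from this[of "b * (y \<bullet> e)"]
    show "0 \<le> exp (b * \<bar>y \<bullet> e\<bar>) \<and> exp (b * \<bar>y \<bullet> e\<bar>) \<le> 2 * cosh (b * (y \<bullet> e))"
      using \<open>b > 0\<close> by (simp add: abs_mult)
  qed
  finally show ?thesis
    by (simp add: prod.distrib)
qed

lemma bounded_l1_norm: "bounded {y::'a::euclidean_space. l1_norm y < R}"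
  unfolding bounded_iff
proof (intro exI ballI)
  fix y :: 'a assume "y \<in> {y. l1_norm y < R}"
  then show "norm y \<le> R"
    using norm_le_l1[of y] by (simp add: l1_norm_def)
qed

section \<open>The Phragmen-Lindelof principle on the cylinder\<close>

theorem theorem1:
  fixes \<Omega> :: "(real ^ 'n) set"
    and v :: "(real ^ 'n) \<times> (real ^ 'k) \<Rightarrow> real"
    and \<delta>\<^sub>0 \<delta> b :: real
  assumes "bounded_lipschitz_domain \<Omega>"
    and "\<delta>\<^sub>0 > 0"
    and "\<And>\<eta>. 0 < \<eta> \<Longrightarrow> \<eta> < \<delta>\<^sub>0 \<Longrightarrow> discrete_domain \<eta> (discretization \<Omega> \<eta>)"
    and "0 < \<delta>" and "\<delta> < \<delta>\<^sub>0"
    and "b > 0"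
    and "cosh (\<delta> * b) = 1 + 1 / (2 * real CARD('k)) * \<delta>\<^sup>2 * first_dirichlet_eigenvalue \<Omega> \<delta>"
    and "discrete_subharmonic_on \<delta> (discretization \<Omega> \<delta> \<times> grid \<delta>) v"
    and "\<forall>x\<in>discrete_boundary \<Omega> \<delta>. \<forall>y\<in>grid \<delta>. v (x, y) \<le> 0"
    and "\<forall>\<epsilon>>0. \<exists>R>0. \<forall>x\<in>discretization \<Omega> \<delta>. \<forall>y\<in>grid \<delta>.
           l1_norm y \<ge> R \<longrightarrow> v (x, y) \<le> \<epsilon> * exp (b * l1_norm y)"
  shows "\<forall>x\<in>discretization \<Omega> \<delta>. \<forall>y\<in>grid \<delta>. v (x, y) \<le> 0"
proof -
  define S where "S = discretization \<Omega> \<delta>"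
  define G where "G = (grid \<delta> :: (real ^ 'k) set)"
  note \<delta> = \<open>0 < \<delta>\<close>
  have bdd: "bounded \<Omega>"
    using assms(1) by (simp add: bounded_lipschitz_domain_def)
  have dom: "discrete_domain \<delta> (discretization \<Omega> \<delta>)"
    using assms(3-5) by blast
  obtain f where fpos: "\<And>x. x \<in> S \<Longrightarrow> 0 < f x" and fzero: "\<And>x. x \<notin> S \<Longrightarrow> f x = 0"
    and feig: "\<And>x. x \<in> S \<Longrightarrow> - discrete_laplacian \<delta> f x = first_dirichlet_eigenvalue \<Omega> \<delta> * f x"
    using positive_first_dirichlet_eigenfunction[OF \<delta> bdd dom] unfolding S_def by metis
  have "finite S" "S \<noteq> {}"
    using finite_bounded_grid[OF \<delta> bdd] dom by (auto simp: S_def discretization_def discrete_domain_def)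
  define g where "g y = (\<Prod>e\<in>Basis. cosh (b * (y \<bullet> e)))" for y :: "real ^ 'k"
  define w where "w p = f (fst p) * g (snd p)" for p
  have gpos: "0 < g y" for y
    by (auto simp: g_def intro: prod_pos)
  have g_lap: "discrete_laplacian \<delta> g y = first_dirichlet_eigenvalue \<Omega> \<delta> * g y" for y
  proof -
    have "2 * real CARD('k) * (cosh (\<delta> * b) - 1) / \<delta>\<^sup>2 = first_dirichlet_eigenvalue \<Omega> \<delta>"
      using \<delta> by (simp add: assms(7))
    then show ?thesis
      using discrete_laplacian_prod_cosh[of \<delta> b y] by (simp add: g_def[abs_def])
  qed
  have harm: "discrete_laplacian \<delta> w (x, y) = 0" if "x \<in> S" for x y
  proof -
    have "discrete_laplacian \<delta> f x = - (first_dirichlet_eigenvalue \<Omega> \<delta> * f x)"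
      using feig[OF that] by simp
    then show ?thesis
      using discrete_laplacian_product[of \<delta> f g x y] g_lap by (simp add: w_def[abs_def])
  qed
  define c where "c = Min (f ` S)"
  have "c > 0"
    using \<open>finite S\<close> \<open>S \<noteq> {}\<close> fpos by (simp add: c_def)
  have wlow: "c * exp (b * l1_norm y) \<le> 2 ^ CARD('k) * w (x, y)" if "x \<in> S" for x y
  proof -
    have "c \<le> f x"
      using \<open>finite S\<close> that by (simp add: c_def)
    have "exp (b * l1_norm y) \<le> 2 ^ CARD('k) * g y"
      using exp_l1_norm_le_prod_cosh[OF \<open>b > 0\<close>, of y] by (simp add: g_def)
    then have "c * exp (b * l1_norm y) \<le> f x * (2 ^ CARD('k) * g y)"
      using \<open>c \<le> f x\<close> \<open>c > 0\<close> by (intro mult_mono) auto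
    then show ?thesis
      by (simp add: w_def mult_ac)
  qed
  have key: "v (x, y) \<le> \<epsilon> * w (x, y)" if "\<epsilon> > 0" "x \<in> S" "y \<in> G" for \<epsilon> x y
  proof -
    \<comment> \<open>chosen so that \<open>\<eta> * exp (b * l1_norm y) \<le> \<epsilon> * w (x, y)\<close>\<close>
    define \<eta> where "\<eta> = \<epsilon> * c / 2 ^ CARD('k)"
    have "\<eta> > 0"
      using \<open>\<epsilon> > 0\<close> \<open>c > 0\<close> by (simp add: \<eta>_def)
    then obtain R where R: "\<And>x y. x \<in> S \<Longrightarrow> y \<in> G \<Longrightarrow> l1_norm y \<ge> R \<Longrightarrow> v (x, y) \<le> \<eta> * exp (b * l1_norm y)"
      using assms(10) unfolding S_def G_def by metis
    define u where "u p = v p - \<epsilon> * w p" for p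
    have far: "u (x, y) \<le> 0" if "x \<in> S" "y \<in> G" "l1_norm y \<ge> R" for x y
    proof -
      have "\<eta> * exp (b * l1_norm y) \<le> \<epsilon> * w (x, y)"
        using mult_left_mono[OF wlow[OF that(1), of y], of "\<epsilon> / 2 ^ CARD('k)"] \<open>\<epsilon> > 0\<close>
        by (simp add: \<eta>_def)
      then show ?thesis
        using R[OF that] by (simp add: u_def)
    qed
    define T where "T = S \<times> ({y. l1_norm y < R} \<inter> G)"
    have "finite T"
      unfolding T_def G_def
      by (intro finite_cartesian_product \<open>finite S\<close> finite_bounded_grid[OF \<delta>] bounded_l1_norm)
    have sub: "discrete_subharmonic_on \<delta> T u"
      using assms(8) harm
      by (auto simp: discrete_subharmonic_on_def u_def[abs_def] discrete_laplacian_diff_scale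
          T_def S_def G_def)
    have bdry: "u q \<le> 0" if "p \<in> T" "grid_neighbor \<delta> p q" "q \<notin> T" for p q
    proof -
      obtain x y x' y' where p: "p = (x, y)" and q: "q = (x', y')"
        by (metis surj_pair)
      have xy: "x \<in> S" "y \<in> G"
        using that(1) by (auto simp: T_def p)
      have nb: "(x' = x \<and> grid_neighbor \<delta> y y') \<or> (grid_neighbor \<delta> x x' \<and> y' = y)"
        using that(2) by (auto simp: p q grid_neighbor_def Basis_prod_def)
      then have "y' \<in> G"
        using xy grid_neighbor_in_grid[of \<delta> y y'] by (auto simp: G_def)
      show ?thesis
      proof (cases "x' \<in> S")
        case True
        then show ?thesis
          using that(3) \<open>y' \<in> G\<close> far[of x' y'] by (auto simp: T_def q)
      next
        case False
        then have "x' \<in> discrete_boundary \<Omega> \<delta>"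
          using nb xy neighbor_in_discrete_boundary[of x \<Omega> \<delta> x'] by (auto simp: S_def)
        then show ?thesis
          using assms(9) \<open>y' \<in> G\<close> fzero[OF False] by (simp add: q u_def w_def G_def)
      qed
    qed
    have "u (x, y) \<le> 0"
    proof (cases "l1_norm y < R")
      case True
      then have "(x, y) \<in> T"
        using that by (simp add: T_def)
      show ?thesis
        by (rule discrete_maximum_principle[OF \<delta> \<open>finite T\<close> sub _ \<open>(x, y) \<in> T\<close>]) (rule bdry)
    next
      case False
      then show ?thesis
        using far that by simp
    qed
    then show ?thesis
      by (simp add: u_def)
  qed
  show ?thesis
  proof (intro ballI)
    fix x y assume xy: "x \<in> discretization \<Omega> \<delta>" "y \<in> (grid \<delta> :: (real ^ 'k) set)"
    then have wpos: "w (x, y) > 0"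
      using fpos[of x] gpos[of y] by (simp add: w_def S_def)
    show "v (x, y) \<le> 0"
    proof (rule field_le_epsilon)
      fix e :: real assume "e > 0"
      then have "v (x, y) \<le> e / w (x, y) * w (x, y)"
        using wpos xy by (intro key) (auto simp: S_def G_def)
      then show "v (x, y) \<le> 0 + e"
        using wpos by simp
    qed
  qed
qed

end
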